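(* Suppose the root system $\Phi$ is finite. Let $\lambda$ be a dominant integral weight and let $\{\beta_i\}_{i\in I}$ be a sequence of positive roots indexed by a totally ordered set $I$ in which each $\alpha\in\Phi^+$ occurs exactly $\langle\lambda,\alpha^\vee\rangle$ times. Then the following two conditions are equivalent. (2) For any roots $\alpha,\beta,\gamma\in\Phi$ with $\alpha\ne\pm\beta$ and $\gamma^\vee=\alpha^\vee+k\beta^\vee$ for some integer $k$, and any $i\in I$ with $\beta_i=\beta$, one has $N_i(\gamma)=N_i(\alpha)+kN_i(\beta)$. (2$'$) For each triple of positive roots $(\alpha,\beta,\gamma)$ with $\gamma^\vee=\alpha^\vee+\beta^\vee$, the finite sequence $\{\beta_j\}_{j\in J}$, where $J=\{j\in I\mid\beta_j\in\{\alpha,\beta,\gamma\}\}$ has the induced total order, is a concatenation of pairs $(\alpha,\gamma)$ and $(\beta,\gamma)$ (in any order).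
   Context: $V$ is a finite-dimensional real vector space with a nondegenerate symmetric bilinear form $\langle\cdot,\cdot\rangle$, and $\Phi\subset V$ is the (finite, reduced, crystallographic) root system of a complex semisimple Lie algebra, with simple roots $\alpha_1,\ldots,\alpha_r$ and positive roots $\Phi^+$. $\alpha^\vee=2\alpha/\langle\alpha,\alpha\rangle$ for $\alpha\in\Phi$. An integral weight is $\lambda\in V$ with $\langle\lambda,\alpha_p^\vee\rangle\in\mathbb{Z}$ for all $p$; it is dominant if $\langle\lambda,\alpha^\vee\rangle\ge0$ for all $\alpha\in\Phi^+$. For $\alpha\in\Phi^+$ and $i\in I$, $N_i(\alpha)=\#\{j<i\mid\beta_j=\alpha\}$ and $N_i(-\alpha)=1-N_i(\alpha)$. *)

theory Defs
  imports "HOL-Analysis.Analysis"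
begin

definition nondegenerate_symmetric_form :: "('v::real_vector \<Rightarrow> 'v \<Rightarrow> real) \<Rightarrow> bool" where
  "nondegenerate_symmetric_form B \<longleftrightarrow>
     bilinear B \<and> (\<forall>x y. B x y = B y x) \<and> (\<forall>x. (\<forall>y. B x y = 0) \<longrightarrow> x = 0)"

definition coroot :: "('v::real_vector \<Rightarrow> 'v \<Rightarrow> real) \<Rightarrow> 'v \<Rightarrow> 'v" where
  "coroot B \<alpha> = (2 / B \<alpha> \<alpha>) *\<^sub>R \<alpha>"

definition root_reflection :: "('v::real_vector \<Rightarrow> 'v \<Rightarrow> real) \<Rightarrow> 'v \<Rightarrow> 'v \<Rightarrow> 'v" where
  "root_reflection B \<alpha> v = v - B v (coroot B \<alpha>) *\<^sub>R \<alpha>"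

(* A finite reduced crystallographic root system of its own span. The roots are not required
   to span the ambient space. The form need not be positive definite; it only has to be
   non-isotropic on roots, which also excludes the zero vector. *)
definition root_system :: "('v::real_vector \<Rightarrow> 'v \<Rightarrow> real) \<Rightarrow> 'v set \<Rightarrow> bool" where
  "root_system B \<Phi> \<longleftrightarrow>
     finite \<Phi> \<and>
     (\<forall>\<alpha>\<in>\<Phi>. B \<alpha> \<alpha> \<noteq> 0) \<and>
     (\<forall>\<alpha>\<in>\<Phi>. root_reflection B \<alpha> ` \<Phi> = \<Phi>) \<and>
     (\<forall>\<alpha>\<in>\<Phi>. \<forall>\<beta>\<in>\<Phi>. B \<beta> (coroot B \<alpha>) \<in> \<int>) \<and>
     (\<forall>\<alpha>\<in>\<Phi>. \<forall>c. c *\<^sub>R \<alpha> \<in> \<Phi> \<longrightarrow> c = 1 \<or> c = -1)"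

definition positive_roots :: "'v::real_vector set \<Rightarrow> 'v set \<Rightarrow> 'v set" where
  "positive_roots \<Phi> \<Delta> = {\<alpha> \<in> \<Phi>. \<exists>c :: 'v \<Rightarrow> nat. \<alpha> = (\<Sum>\<delta>\<in>\<Delta>. real (c \<delta>) *\<^sub>R \<delta>)}"

definition simple_roots :: "'v::real_vector set \<Rightarrow> 'v set \<Rightarrow> bool" where
  "simple_roots \<Phi> \<Delta> \<longleftrightarrow>
     \<Delta> \<subseteq> \<Phi> \<and> independent \<Delta> \<and>
     (\<forall>\<alpha>\<in>\<Phi>. \<alpha> \<in> positive_roots \<Phi> \<Delta> \<or> - \<alpha> \<in> positive_roots \<Phi> \<Delta>)"

definition integral_weight :: "('v::real_vector \<Rightarrow> 'v \<Rightarrow> real) \<Rightarrow> 'v set \<Rightarrow> 'v \<Rightarrow> bool" where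
  "integral_weight B \<Delta> lam \<longleftrightarrow> (\<forall>\<delta>\<in>\<Delta>. B lam (coroot B \<delta>) \<in> \<int>)"

definition dominant :: "('v::real_vector \<Rightarrow> 'v \<Rightarrow> real) \<Rightarrow> 'v set \<Rightarrow> 'v set \<Rightarrow> 'v \<Rightarrow> bool" where
  "dominant B \<Phi> \<Delta> lam \<longleftrightarrow> (\<forall>\<alpha>\<in>positive_roots \<Phi> \<Delta>. B lam (coroot B \<alpha>) \<ge> 0)"

(* N_i(alpha) for the sequence b indexed by I: counted directly when alpha is positive, and by
   N_i(-alpha) = 1 - N_i(alpha) otherwise. Only meaningful when alpha is a root. *)
definition root_count ::
  "'v::real_vector set \<Rightarrow> 'v set \<Rightarrow> 'i::linorder set \<Rightarrow> ('i \<Rightarrow> 'v) \<Rightarrow> 'i \<Rightarrow> 'v \<Rightarrow> int" where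
  "root_count \<Phi> \<Delta> I b i \<alpha> =
     (if \<alpha> \<in> positive_roots \<Phi> \<Delta> then int (card {j \<in> I. j < i \<and> b j = \<alpha>})
      else 1 - int (card {j \<in> I. j < i \<and> b j = - \<alpha>}))"

(* The finite sequence (b j), j in J, in increasing order of j. *)
definition subsequence_list :: "('i::linorder \<Rightarrow> 'v) \<Rightarrow> 'i set \<Rightarrow> 'v list" where
  "subsequence_list b J = map b (sorted_list_of_set J)"

end

theory Submission
  imports Defs
begin

text \<open>
  For positive roots with \<open>\<gamma>\<^sup>\<or> = \<alpha>\<^sup>\<or> + \<beta>\<^sup>\<or>\<close>, consider the balance \<open>N\<^sub>i(\<alpha>) + N\<^sub>i(\<beta>) - N\<^sub>i(\<gamma>)\<close>. The
  subsequence of entries \<open>\<alpha>, \<beta>, \<gamma>\<close> is a concatenation of pairs exactly when the balance is \<open>0\<close>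
  before each \<open>\<alpha>\<close> or \<open>\<beta>\<close>, is \<open>1\<close> before each \<open>\<gamma>\<close>, and ends at \<open>0\<close>; the last property is
  automatic by linearity of \<open>\<langle>\<lambda>, -\<rangle>\<close>. Applied to \<open>\<gamma>\<^sup>\<or> = \<alpha>\<^sup>\<or> + \<beta>\<^sup>\<or>\<close>, to \<open>\<gamma>\<^sup>\<or> = \<beta>\<^sup>\<or> + \<alpha>\<^sup>\<or>\<close> and to
  \<open>\<alpha>\<^sup>\<or> = (-\<beta>)\<^sup>\<or> + \<gamma>\<^sup>\<or>\<close>, the first condition gives these values. Conversely they give the first
  condition for \<open>k = 1\<close> after moving negative roots to the other side, and the general case follows
  because the \<open>\<beta>\<^sup>\<or>\<close>-string through \<open>\<alpha>\<^sup>\<or>\<close> in the coroot system has no gaps.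
\<close>

section \<open>Root systems for a form that may be indefinite, and their coroots\<close>

locale root_system_with_form =
  fixes B :: "'v::real_vector \<Rightarrow> 'v \<Rightarrow> real" and \<Phi> :: "'v set"
  assumes form: "nondegenerate_symmetric_form B" and roots: "root_system B \<Phi>"
begin

lemma bilinear: "bilinear B" and sym: "B x y = B y x"
  using form by (auto simp: nondegenerate_symmetric_form_def)

lemmas form_simps =
  bilinear_ladd[OF bilinear] bilinear_radd[OF bilinear]
  bilinear_lmul[OF bilinear] bilinear_rmul[OF bilinear]
  bilinear_lneg[OF bilinear] bilinear_rneg[OF bilinear]
  bilinear_lsub[OF bilinear] bilinear_rsub[OF bilinear]
  bilinear_lzero[OF bilinear] bilinear_rzero[OF bilinear]

lemma finite_roots: "finite \<Phi>"
  and norm_nonzero: "x \<in> \<Phi> \<Longrightarrow> B x x \<noteq> 0"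
  and reflection_image: "x \<in> \<Phi> \<Longrightarrow> root_reflection B x ` \<Phi> = \<Phi>"
  and cartan_integer: "x \<in> \<Phi> \<Longrightarrow> y \<in> \<Phi> \<Longrightarrow> B y (coroot B x) \<in> \<int>"
  and reduced: "x \<in> \<Phi> \<Longrightarrow> c *\<^sub>R x \<in> \<Phi> \<Longrightarrow> c = 1 \<or> c = -1"
  using roots unfolding root_system_def by blast+

lemma root_nonzero: "x \<in> \<Phi> \<Longrightarrow> x \<noteq> 0"
  using norm_nonzero[of x] by (auto simp: form_simps)

lemma reflection_root: "x \<in> \<Phi> \<Longrightarrow> y \<in> \<Phi> \<Longrightarrow> root_reflection B x y \<in> \<Phi>"
  using reflection_image by blast

lemma coroot_self: "x \<in> \<Phi> \<Longrightarrow> B x (coroot B x) = 2"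
  using norm_nonzero by (auto simp: coroot_def form_simps)

lemma reflection_self: "x \<in> \<Phi> \<Longrightarrow> root_reflection B x x = - x"
  using coroot_self[of x] by (simp add: root_reflection_def scaleR_2)

lemma uminus_root: "x \<in> \<Phi> \<Longrightarrow> - x \<in> \<Phi>"
  using reflection_root[of x x] by (simp add: reflection_self)

lemma form_reflection:
  assumes "x \<in> \<Phi>"
  shows "B (root_reflection B x v) (root_reflection B x w) = B v w"
  using norm_nonzero[OF assms]
  by (simp add: root_reflection_def coroot_def form_simps sym[of x w] sym[of x v] field_simps)

lemma coroot_reflection:
  assumes "x \<in> \<Phi>"
  shows "coroot B (root_reflection B x y) = root_reflection B x (coroot B y)"
  unfolding coroot_def[of B "root_reflection B x y"] form_reflection[OF assms]
  by (simp add: root_reflection_def coroot_def[of B y] form_simps algebra_simps)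

lemma coroot_uminus: "coroot B (- x) = - coroot B x"
  by (simp add: coroot_def form_simps)

lemma coroot_coroot: "x \<in> \<Phi> \<Longrightarrow> coroot B (coroot B x) = x"
  using norm_nonzero[of x] by (simp add: coroot_def form_simps)

lemma inj_on_coroot: "inj_on (coroot B) \<Phi>"
  by (metis coroot_coroot inj_onI)

lemma reflection_coroot: "x \<in> \<Phi> \<Longrightarrow> root_reflection B (coroot B x) v = root_reflection B x v"
  by (simp add: root_reflection_def coroot_coroot coroot_def form_simps algebra_simps)

text \<open>The relations of interest hold among coroots, so the later results on sums and strings
  of roots are applied to this dual system.\<close>

lemma coroot_system: "root_system B (coroot B ` \<Phi>)"
  unfolding root_system_def
proof (intro conjI ballI allI impI)
  show "finite (coroot B ` \<Phi>)"
    using finite_roots by simp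
next
  fix x assume "x \<in> coroot B ` \<Phi>"
  then obtain r where r: "r \<in> \<Phi>" "x = coroot B r" by blast
  show "B x x \<noteq> 0"
    using norm_nonzero[OF r(1)] by (simp add: r(2) coroot_def form_simps)
  show "root_reflection B x ` coroot B ` \<Phi> = coroot B ` \<Phi>"
  proof -
    have "root_reflection B x ` coroot B ` \<Phi> = coroot B ` root_reflection B r ` \<Phi>"
      using r by (simp add: image_image reflection_coroot coroot_reflection)
    then show ?thesis
      using reflection_image[OF r(1)] by simp
  qed
  show "B y (coroot B x) \<in> \<int>" if "y \<in> coroot B ` \<Phi>" for y
    using that r cartan_integer by (auto simp: coroot_coroot sym)
  show "c = 1 \<or> c = -1" if c: "c *\<^sub>R x \<in> coroot B ` \<Phi>" for c
  proof -
    obtain s where s: "s \<in> \<Phi>" "c *\<^sub>R x = coroot B s"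
      using c by blast
    have "s = coroot B (c *\<^sub>R x)"
      using s by (simp add: coroot_coroot)
    \<comment> \<open>The factor \<open>c / (c * c)\<close> stays uncancelled so that the equation
      also covers \<open>c = 0\<close>, where both sides vanish.\<close>
    also have "\<dots> = (c / (c * c)) *\<^sub>R coroot B x"
      by (simp add: coroot_def form_simps)
    also have "coroot B x = r"
      using r by (simp add: coroot_coroot)
    finally have "s = (1 / c) *\<^sub>R r"
      by (cases "c = 0") auto
    then have "1 / c = 1 \<or> 1 / c = -1"
      using reduced[OF r(1)] s(1) by blast
    then show ?thesis
      by (cases "c = 0") (auto simp: divide_eq_eq)
  qed
qed

section \<open>An invariant semidefinite form and bounds on Cartan integers\<close>

text \<open>
  Since the given form may be indefinite, Cauchy-Schwarz is applied to an invariant form that is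
  positive semidefinite. It is not known to be definite on the span of the roots, so the equality
  case is handled separately, by producing infinitely many roots.
\<close>

definition root_form :: "'v \<Rightarrow> 'v \<Rightarrow> real" where
  "root_form v w = (\<Sum>r\<in>\<Phi>. B v (coroot B r) * B w (coroot B r))"

lemma root_form_sym: "root_form v w = root_form w v"
  by (simp add: root_form_def mult.commute)

lemma root_form_diff: "root_form (v - u) w = root_form v w - root_form u w"
  and root_form_scale: "root_form (c *\<^sub>R v) w = c * root_form v w"
  and root_form_uminus: "root_form v (- w) = - root_form v w"
  by (simp_all add: root_form_def form_simps algebra_simps sum_subtractf sum_distrib_left sum_negf)

text \<open>A reflection preserves \<open>B\<close> and permutes the coroots, so it only reorders
  the terms of the sum.\<close>

lemma root_form_reflection:
  assumes "x \<in> \<Phi>"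
  shows "root_form (root_reflection B x v) (root_reflection B x w) = root_form v w"
proof -
  let ?s = "root_reflection B x"
  have inj: "inj_on ?s \<Phi>"
    using finite_roots reflection_image[OF assms] by (simp add: finite_surj_inj)
  have "root_form (?s v) (?s w) =
      (\<Sum>r\<in>?s ` \<Phi>. B (?s v) (coroot B r) * B (?s w) (coroot B r))"
    by (simp add: root_form_def reflection_image[OF assms])
  also have "\<dots> = root_form v w"
    by (simp add: sum.reindex[OF inj] coroot_reflection[OF assms] form_reflection[OF assms]
        root_form_def)
  finally show ?thesis .
qed

text \<open>Reflecting both arguments in \<open>y\<close> turns \<open>y\<close> into
  \<open>- y\<close>; comparing the two values shows that \<open>root_form\<close> yields the same
  Cartan integers as \<open>B\<close>.\<close>

lemma root_form_root:
  assumes "y \<in> \<Phi>"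
  shows "2 * root_form v y = B v (coroot B y) * root_form y y"
proof -
  have "root_form v y = root_form (root_reflection B y v) (- y)"
    using root_form_reflection[OF assms, of v y] by (simp add: reflection_self assms)
  then show ?thesis
    by (simp add: root_form_uminus root_reflection_def root_form_diff root_form_scale)
qed

text \<open>The summand at \<open>r = x\<close> is the square of 2, and all others are
  squares.\<close>

lemma root_form_pos:
  assumes "x \<in> \<Phi>"
  shows "root_form x x > 0"
proof -
  have "B x (coroot B x) * B x (coroot B x) \<le> root_form x x"
    unfolding root_form_def using finite_roots assms by (intro member_le_sum) auto
  then show ?thesis
    by (simp add: coroot_self assms)
qed

text \<open>Up to the positive factors \<open>root_form y y\<close> and
  \<open>root_form x x\<close>, both integers equal \<open>2 * root_form x y\<close>.\<close>

lemma cartan_integer_sign: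
  assumes "x \<in> \<Phi>" "y \<in> \<Phi>"
  shows "sgn (B x (coroot B y)) = sgn (B y (coroot B x))"
proof -
  have "sgn (B x (coroot B y) * root_form y y) = sgn (B y (coroot B x) * root_form x x)"
    using root_form_root[OF assms(2), of x] root_form_root[OF assms(1), of y]
    by (simp add: root_form_sym)
  then show ?thesis
    using root_form_pos assms by (simp add: sgn_mult)
qed

text \<open>Each factor is \<open>2 * root_form x y\<close> divided by a positive norm, so the bound
  is Cauchy-Schwarz for the sum defining \<open>root_form\<close>.\<close>

lemma cartan_integer_product_le:
  assumes "x \<in> \<Phi>" "y \<in> \<Phi>"
  shows "B x (coroot B y) * B y (coroot B x) \<le> 4"
proof -
  have "(root_form x y)\<^sup>2 \<le> root_form x x * root_form y y"
    using Cauchy_Schwarz_ineq_sum[of "\<lambda>r. B x (coroot B r)" "\<lambda>r. B y (coroot B r)" \<Phi>]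
    by (simp add: root_form_def power2_eq_square)
  moreover have "(B x (coroot B y) * B y (coroot B x)) * (root_form x x * root_form y y)
      = (2 * root_form x y) * (2 * root_form y x)"
    using root_form_root[OF assms(2), of x] root_form_root[OF assms(1), of y]
    by (simp add: mult_ac)
  ultimately have "(B x (coroot B y) * B y (coroot B x)) * (root_form x x * root_form y y)
      \<le> 4 * (root_form x x * root_form y y)"
    by (simp add: power2_eq_square root_form_sym)
  then show ?thesis
    using root_form_pos assms by (meson mult_le_cancel_right_pos mult_pos_pos)
qed

text \<open>Written with \<open>B\<close>, the two Cartan integers share the numerator
  \<open>2 * B x y\<close>, so their equal signs pass to the denominators.\<close>

lemma norm_sign:
  assumes "x \<in> \<Phi>" "y \<in> \<Phi>" "B x y \<noteq> 0"
  shows "sgn (B x x) = sgn (B y y)"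
  using cartan_integer_sign[OF assms(1,2)] assms(3)
  by (simp add: coroot_def form_simps sgn_mult sym[of y x])
   (auto simp: sgn_if split: if_splits)

section \<open>Sums and strings of roots\<close>

lemma affine_case:
  assumes x: "x \<in> \<Phi>" and y: "y \<in> \<Phi>"
    and xy: "B x (coroot B y) = -2" and yx: "B y (coroot B x) = -2"
  shows "x = - y"
proof (rule ccontr)
  assume "x \<noteq> - y"
  then have u: "x + y \<noteq> 0"
    by (simp add: eq_neg_iff_add_eq_0)
  \<comment> \<open>Both reflections fix \<open>x + y\<close>. Reflecting first in \<open>y\<close>
    and then in \<open>x\<close> translates each member of this family by \<open>-2 (x + y)\<close>,
    which yields infinitely many roots.\<close>
  have mem: "y - (2 * real m) *\<^sub>R (x + y) \<in> \<Phi>" for m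
  proof (induction m)
    case (Suc m)
    let ?w = "y - (2 * real m) *\<^sub>R (x + y)"
    have 1: "root_reflection B y ?w = ?w - 2 *\<^sub>R y"
      using xy coroot_self[OF y] by (simp add: root_reflection_def form_simps)
    have 2: "root_reflection B x (?w - 2 *\<^sub>R y) = ?w - 2 *\<^sub>R y - 2 *\<^sub>R x"
      using yx coroot_self[OF x] by (simp add: root_reflection_def form_simps)
    have "?w - 2 *\<^sub>R y - 2 *\<^sub>R x \<in> \<Phi>"
      using reflection_root[OF x reflection_root[OF y Suc.IH]] 1 2 by simp
    then show ?case
      by (simp add: algebra_simps)
  qed (use y in simp)
  have "inj (\<lambda>m. y - (2 * real m) *\<^sub>R (x + y))"
    using u by (auto intro!: injI)
  then have "infinite (range (\<lambda>m. y - (2 * real m) *\<^sub>R (x + y)))"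
    using finite_imageD infinite_UNIV_nat by blast
  then show False
    using mem finite_roots finite_subset by (metis (no_types, lifting) image_subsetI)
qed

text \<open>One of the two Cartan integers must be -1, and the corresponding reflection then adds
  one root to the other.\<close>

lemma sum_root:
  assumes x: "x \<in> \<Phi>" and y: "y \<in> \<Phi>" and ne: "x \<noteq> - y"
    and neg: "B x (coroot B y) < 0"
  shows "x + y \<in> \<Phi>"
proof -
  obtain m n where mn: "B x (coroot B y) = of_int m" "B y (coroot B x) = of_int n"
    using cartan_integer x y by (metis Ints_cases)
  have "m < 0"
    using neg mn by simp
  moreover have "n < 0"
    using cartan_integer_sign[OF x y] mn neg by (simp add: sgn_if split: if_splits)
  moreover have "m * n \<le> 4"
    using cartan_integer_product_le[OF x y] mn
    by (metis of_int_le_iff of_int_mult of_int_numeral)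
  moreover have "m \<noteq> -2 \<or> n \<noteq> -2"
    using affine_case[OF x y] ne mn by auto
  ultimately have "m = -1 \<or> n = -1"
  proof -
    \<comment> \<open>Each excluded case would make \<open>m * n\<close> at least 6.\<close>
    have "\<not> (m \<le> -3 \<and> n \<le> -2)" "\<not> (m \<le> -2 \<and> n \<le> -3)"
      using \<open>m * n \<le> 4\<close> mult_mono[of 3 "-m" 2 "-n"] mult_mono[of 2 "-m" 3 "-n"] by auto
    then show ?thesis
      using \<open>m < 0\<close> \<open>n < 0\<close> \<open>m \<noteq> -2 \<or> n \<noteq> -2\<close> by linarith
  qed
  then show ?thesis
  proof
    assume "m = -1"
    then show ?thesis
      using reflection_root[OF y x] mn by (simp add: root_reflection_def)
  next
    assume "n = -1"
    then show ?thesis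
      using reflection_root[OF x y] mn by (simp add: root_reflection_def add.commute)
  qed
qed

text \<open>A gap right after \<open>x\<close> would end at a root \<open>z\<close> whose Cartan
  integer against \<open>y\<close> is positive, but then \<open>z - y\<close> is a root as well, so
  the gap would end earlier.\<close>

lemma root_string_step:
  assumes x: "x \<in> \<Phi>" and y: "y \<in> \<Phi>" and ne: "x \<noteq> y" "x \<noteq> - y"
    and k: "k > 0" "x + real k *\<^sub>R y \<in> \<Phi>"
  shows "x + y \<in> \<Phi>"
proof (rule ccontr)
  assume no: "x + y \<notin> \<Phi>"
  define q where "q = (LEAST q. q > 0 \<and> x + real q *\<^sub>R y \<in> \<Phi>)"
  have q: "q > 0" "x + real q *\<^sub>R y \<in> \<Phi>"
    using LeastI[of "\<lambda>q. q > 0 \<and> x + real q *\<^sub>R y \<in> \<Phi>" k] k by (simp_all add: q_def)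
  have least: "x + real p *\<^sub>R y \<notin> \<Phi>" if "p > 0" "p < q" for p
    using not_less_Least[of p "\<lambda>q. q > 0 \<and> x + real q *\<^sub>R y \<in> \<Phi>"] that by (simp add: q_def)
  have "q \<noteq> 1"
    using no q by auto
  then have q2: "q \<ge> 2"
    using q by simp
  let ?z = "x + real q *\<^sub>R y"
  have "B x (coroot B y) \<ge> 0"
    using sum_root[OF x y ne(2)] no by fastforce
  then have pos: "B ?z (coroot B y) > 0"
    using q by (simp add: form_simps coroot_self y)
  have "?z \<noteq> - (- y)"
  proof
    assume "?z = - (- y)"
    then have "x = (1 - real q) *\<^sub>R y"
      by (simp add: algebra_simps)
    moreover from this have "1 - real q = 1 \<or> 1 - real q = -1"
      using reduced[OF y] x by blast
    ultimately show False
      using ne by auto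
  qed
  then have "?z + - y \<in> \<Phi>"
    using pos q by (intro sum_root[of ?z "- y"]) (simp_all add: uminus_root y coroot_uminus form_simps)
  moreover have "?z + - y = x + real (q - 1) *\<^sub>R y"
    using q2 by (simp add: algebra_simps)
  ultimately have "x + real (q - 1) *\<^sub>R y \<in> \<Phi>"
    by (simp only:)
  then show False
    using least[of "q - 1"] q2 by simp
qed

text \<open>Non-orthogonal roots have norms of the same sign, and non-orthogonality always connects
  \<open>x\<close>, \<open>y\<close> and \<open>x + y\<close>: through \<open>x + y\<close> if
  \<open>x\<close> and \<open>y\<close> are orthogonal, otherwise through the edge between
  \<open>x\<close> and \<open>y\<close>.\<close>

lemma norm_sign_sum:
  assumes x: "x \<in> \<Phi>" and y: "y \<in> \<Phi>" and xy: "x + y \<in> \<Phi>"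
  shows "sgn (B y y) = sgn (B x x) \<and> sgn (B (x + y) (x + y)) = sgn (B x x)"
proof (cases "B x y = 0")
  case True
  then have "B (x + y) x \<noteq> 0" "B (x + y) y \<noteq> 0"
    using norm_nonzero x y by (auto simp: form_simps sym)
  then show ?thesis
    using norm_sign[OF xy x] norm_sign[OF xy y] by auto
next
  case False
  have "B (x + y) x + B (x + y) y \<noteq> 0"
    using norm_nonzero[OF xy] by (simp add: form_simps)
  then have "B (x + y) x \<noteq> 0 \<or> B (x + y) y \<noteq> 0"
    by auto
  then show ?thesis
    using norm_sign[OF x y False] norm_sign[OF xy x] norm_sign[OF xy y] by auto
qed

lemma coroot_root_system: "root_system_with_form B (coroot B ` \<Phi>)"
  using form coroot_system by unfold_locales

lemma coroot_norm_sign: "sgn (B (coroot B x) (coroot B x)) = sgn (B x x)"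
  by (auto simp: coroot_def form_simps sgn_mult)

end

section \<open>Positive roots and sums of positive coroots\<close>

locale based_root_system = root_system_with_form B \<Phi>
  for B :: "'v::real_vector \<Rightarrow> 'v \<Rightarrow> real" and \<Phi> :: "'v set" +
  fixes \<Delta> :: "'v set"
  assumes simple: "simple_roots \<Phi> \<Delta>"
begin

sublocale coroots: root_system_with_form B "coroot B ` \<Phi>"
  by (rule coroot_root_system)

lemma positive_imp_root: "x \<in> positive_roots \<Phi> \<Delta> \<Longrightarrow> x \<in> \<Phi>"
  by (simp add: positive_roots_def)

text \<open>Three terms cover both uses: \<open>x\<close>, \<open>x\<close>, \<open>- x\<close> with
  weights 1, 1, 2 separates positive from negative roots, and \<open>x\<close>, \<open>y\<close>,
  \<open>- z\<close> with rescaled coroot coefficients treats a sum of coroots.\<close>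

lemma positive_combination_nonzero:
  assumes "x \<in> positive_roots \<Phi> \<Delta>" "y \<in> positive_roots \<Phi> \<Delta>" "z \<in> positive_roots \<Phi> \<Delta>"
    and pos: "p > 0" "q > 0" "r > 0"
  shows "p *\<^sub>R x + q *\<^sub>R y + r *\<^sub>R z \<noteq> 0"
proof
  assume zero: "p *\<^sub>R x + q *\<^sub>R y + r *\<^sub>R z = 0"
  obtain c d e :: "'v \<Rightarrow> nat" where c: "x = (\<Sum>\<delta>\<in>\<Delta>. real (c \<delta>) *\<^sub>R \<delta>)"
    and d: "y = (\<Sum>\<delta>\<in>\<Delta>. real (d \<delta>) *\<^sub>R \<delta>)" and e: "z = (\<Sum>\<delta>\<in>\<Delta>. real (e \<delta>) *\<^sub>R \<delta>)"
    using assms(1-3) unfolding positive_roots_def by blast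
  have ind: "independent \<Delta>" and fin: "finite \<Delta>"
    using simple finite_roots finite_subset by (auto simp: simple_roots_def)
  have "(\<Sum>\<delta>\<in>\<Delta>. (p * c \<delta> + q * d \<delta> + r * e \<delta>) *\<^sub>R \<delta>) = 0"
    using zero unfolding c d e by (simp add: scaleR_sum_right sum.distrib algebra_simps)
  then have "p * c \<delta> + q * d \<delta> + r * e \<delta> = 0" if "\<delta> \<in> \<Delta>" for \<delta>
    using real_vector.independentD[OF ind fin order_refl,
        of "\<lambda>\<delta>. p * c \<delta> + q * d \<delta> + r * e \<delta>"] that by blast
  moreover have "p * c \<delta> \<ge> 0" "q * d \<delta> \<ge> 0" "r * e \<delta> \<ge> 0" for \<delta>
    using pos by simp_all
  ultimately have "p * c \<delta> = 0" if "\<delta> \<in> \<Delta>" for \<delta>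
    using that by (smt (verit))
  then have "x = 0"
    using pos by (simp add: c)
  then show False
    using root_nonzero positive_imp_root assms(1) by blast
qed

lemma positive_imp_uminus_not_positive:
  assumes "x \<in> positive_roots \<Phi> \<Delta>"
  shows "- x \<notin> positive_roots \<Phi> \<Delta>"
  using positive_combination_nonzero[of x x "- x" 1 1 2] assms by (auto simp: scaleR_2)

lemma uminus_positive_iff:
  assumes "x \<in> \<Phi>"
  shows "- x \<in> positive_roots \<Phi> \<Delta> \<longleftrightarrow> x \<notin> positive_roots \<Phi> \<Delta>"
  using assms simple positive_imp_uminus_not_positive by (auto simp: simple_roots_def)

text \<open>
  The form may be indefinite, so a coroot can be a negative multiple of its root; the three
  roots below nevertheless have norms of the same sign.
\<close>

lemma coroot_sum_positive:
  assumes x: "x \<in> positive_roots \<Phi> \<Delta>" and y: "y \<in> positive_roots \<Phi> \<Delta>" and z: "z \<in> \<Phi>"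
    and sum: "coroot B z = coroot B x + coroot B y"
  shows "z \<in> positive_roots \<Phi> \<Delta>"
proof (rule ccontr)
  assume "z \<notin> positive_roots \<Phi> \<Delta>"
  then have neg: "- z \<in> positive_roots \<Phi> \<Delta>"
    using uminus_positive_iff z by blast
  let ?s = "sgn (B x x)"
  have nz: "B x x \<noteq> 0" "B y y \<noteq> 0" "B z z \<noteq> 0"
    using norm_nonzero positive_imp_root x y z by blast+
  have s: "sgn (B y y) = ?s" "sgn (B z z) = ?s"
    using coroots.norm_sign_sum[of "coroot B x" "coroot B y"] positive_imp_root x y z
    by (auto simp: sum[symmetric] coroot_norm_sign)
  \<comment> \<open>Absolute values keep all three coefficients positive. The common sign of the
    norms then factors out, so the coroot relation becomes a vanishing positive combination.\<close>
  have abs: "(2 / \<bar>B w w\<bar>) *\<^sub>R w = sgn (B w w) *\<^sub>R coroot B w" for w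
    by (simp add: coroot_def abs_if sgn_if)
  have "(2 / \<bar>B x x\<bar>) *\<^sub>R x + (2 / \<bar>B y y\<bar>) *\<^sub>R y + (2 / \<bar>B z z\<bar>) *\<^sub>R (- z) = 0"
    unfolding scaleR_minus_right abs s sum by (simp add: scaleR_add_right)
  then show False
    using positive_combination_nonzero[OF x y neg] nz by simp
qed

lemma root_count_uminus:
  assumes "x \<in> \<Phi>"
  shows "root_count \<Phi> \<Delta> I b i (- x) = 1 - root_count \<Phi> \<Delta> I b i x"
  using uminus_positive_iff[OF assms] by (auto simp: root_count_def)

text \<open>A coincidence would make a coroot zero or twice another coroot; opposite roots cannot
  both be positive.\<close>

lemma distinct_of_coroot_sum:
  assumes "x \<in> positive_roots \<Phi> \<Delta>" "y \<in> positive_roots \<Phi> \<Delta>" "z \<in> \<Phi>"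
    and sum: "coroot B z = coroot B x + coroot B y"
  shows "x \<noteq> y" "z \<noteq> x" "z \<noteq> y" "x \<noteq> - y" "z \<noteq> - x" "z \<noteq> - y"
proof -
  have roots: "x \<in> \<Phi>" "y \<in> \<Phi>"
    using positive_imp_root assms by blast+
  have nz: "coroot B x \<noteq> 0" "coroot B y \<noteq> 0"
    using coroots.root_nonzero roots by blast+
  have nosmul: "coroot B v \<noteq> 2 *\<^sub>R coroot B w" if "v \<in> \<Phi>" "w \<in> \<Phi>" for v w
  proof
    assume "coroot B v = 2 *\<^sub>R coroot B w"
    then show False
      using coroots.reduced[of "coroot B w" 2] that imageI[of v \<Phi> "coroot B"] by auto
  qed
  have pos: "z \<in> positive_roots \<Phi> \<Delta>"
    using coroot_sum_positive assms by blast
  show "x \<noteq> y"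
    using nosmul[of z y] roots sum assms(3) by (auto simp: scaleR_2)
  show "z \<noteq> x" "z \<noteq> y"
    using nz sum by auto
  show "x \<noteq> - y" "z \<noteq> - x" "z \<noteq> - y"
    using positive_imp_uminus_not_positive assms(1,2) pos by blast+
qed

end

section \<open>Concatenated pairs and the balance of prefixes\<close>

lemma concat_pairs_iff:
  assumes "set xs \<subseteq> {a, b, g}" "a \<noteq> b" "g \<noteq> a" "g \<noteq> b"
  shows "(\<exists>ps. set ps \<subseteq> {[a, g], [b, g]} \<and> xs = concat ps) \<longleftrightarrow>
    count_list xs a + count_list xs b = count_list xs g \<and>
    (\<forall>us x vs. xs = us @ x # vs \<longrightarrow>
      count_list us a + count_list us b = count_list us g + (if x = g then 1 else 0))"
    (is "?L \<longleftrightarrow> ?R xs")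
proof
  have "?R (concat ps)" if "set ps \<subseteq> {[a, g], [b, g]}" for ps
    using that
  proof (induction ps)
    case (Cons p ps)
    then obtain y where y: "p = [y, g]" "y = a \<or> y = b"
      by auto
    have IH: "?R (concat ps)"
      using Cons.prems by (intro Cons.IH) simp
    show ?case
    proof (intro conjI allI impI)
      show "count_list (concat (p # ps)) a + count_list (concat (p # ps)) b =
          count_list (concat (p # ps)) g"
        using IH y assms by auto
      fix us x vs
      assume eq: "concat (p # ps) = us @ x # vs"
      \<comment> \<open>Prefixes of length 0 and 1 stop within the first pair; longer ones contain
        it, and a full pair leaves the balance unchanged.\<close>
      show "count_list us a + count_list us b = count_list us g + (if x = g then 1 else 0)"
      proof (cases us)
        case Nil
        then show ?thesis
          using eq y assms by auto
      next
        case (Cons u us1)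
        show ?thesis
        proof (cases us1)
          case Nil
          then show ?thesis
            using eq y assms Cons by auto
        next
          case (Cons v us2)
          then have "concat ps = us2 @ x # vs" and us: "us = y # g # us2"
            using eq y \<open>us = u # us1\<close> by auto
          then have "count_list us2 a + count_list us2 b = count_list us2 g + (if x = g then 1 else 0)"
            using IH by blast
          then show ?thesis
            using us y assms by auto
        qed
      qed
    qed
  qed simp
  note R = this
  assume ?L
  then obtain ps where ps: "set ps \<subseteq> {[a, g], [b, g]}" "xs = concat ps"
    by blast
  show "?R xs"
    unfolding ps(2) by (rule R[OF ps(1)])
next
  assume "?R xs"
  then show ?L
    using assms(1)
  proof (induction xs rule: length_induct)
    case (1 xs)
    note R = "1.prems"(1)
    show ?case
    proof (cases xs)
      case Nil
      then show ?thesis by (intro exI[of _ "[]"]) simp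
    next
      case (Cons y ys)
      \<comment> \<open>Before the first entry the balance is 0, so this entry is not
        \<open>g\<close>.\<close>
      have y: "y = a \<or> y = b"
        using R[THEN conjunct2, rule_format, of "[]" y ys] "1.prems"(2) Cons
        by (auto split: if_splits)
      \<comment> \<open>The final balance 0 rules out a list ending after an unmatched
        \<open>a\<close> or \<open>b\<close>. The balance is now 1, so the next entry must be
        \<open>g\<close>.\<close>
      then obtain z zs where ys: "ys = z # zs"
        using R Cons assms by (cases ys) auto
      have z: "z = g"
        using R[THEN conjunct2, rule_format, of "[y]" z zs] y Cons ys assms
        by (auto split: if_splits)
      have R_zs: "?R zs"
      proof (intro conjI allI impI)
        show "count_list zs a + count_list zs b = count_list zs g"
          using R Cons ys y z assms by auto
        fix us x vs
        assume "zs = us @ x # vs"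
        then show "count_list us a + count_list us b = count_list us g + (if x = g then 1 else 0)"
          using R[THEN conjunct2, rule_format, of "y # z # us" x vs] Cons ys y z assms by auto
      qed
      have "length zs < length xs" and set: "set zs \<subseteq> {a, b, g}"
        using "1.prems"(2) Cons ys by auto
      then have "\<exists>ps. set ps \<subseteq> {[a, g], [b, g]} \<and> zs = concat ps"
        using "1.IH"[THEN spec, THEN mp, THEN mp, THEN mp, OF _ R_zs set] by (simp only:)
      then obtain ps where "set ps \<subseteq> {[a, g], [b, g]}" "zs = concat ps"
        by (elim exE conjE)
      then show ?thesis
        using y Cons ys z by (intro exI[of _ "[y, g] # ps"]) auto
    qed
  qed
qed

text \<open>The entries before \<open>i\<close> in a strictly increasing list are exactly the
  smaller elements of the set. This turns conditions on list prefixes into conditions on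
  indices.\<close>

lemma map_sorted_list_of_set_splits:
  fixes J :: "'i::linorder set"
  assumes "finite J"
  shows "(\<forall>us x vs. map f (sorted_list_of_set J) = us @ x # vs \<longrightarrow> P us x) \<longleftrightarrow>
    (\<forall>i\<in>J. P (map f (sorted_list_of_set {j \<in> J. j < i})) (f i))"
proof -
  have prefix: "us = sorted_list_of_set {j \<in> J. j < i}"
    if "sorted_list_of_set J = us @ i # vs" for us i vs
  proof -
    have sorted: "sorted_wrt (<) (us @ i # vs)"
      using strict_sorted_list_of_set[of J] that by simp
    have "J = set (us @ i # vs)"
      using assms by (simp flip: that)
    then have "{j \<in> J. j < i} = set us"
      using sorted by (auto simp: sorted_wrt_append)
    moreover have "sorted_wrt (<) us"
      using sorted by (simp add: sorted_wrt_append)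
    ultimately show ?thesis
      by (simp add: sorted_list_of_set.idem_if_sorted_distinct strict_sorted_iff)
  qed
  show ?thesis
  proof (intro iffI ballI allI impI)
    fix i
    assume L: "\<forall>us x vs. map f (sorted_list_of_set J) = us @ x # vs \<longrightarrow> P us x" and "i \<in> J"
    then obtain us vs where "sorted_list_of_set J = us @ i # vs"
      using assms by (metis set_sorted_list_of_set split_list)
    then show "P (map f (sorted_list_of_set {j \<in> J. j < i})) (f i)"
      using L prefix by fastforce
  next
    fix us x vs
    assume R: "\<forall>i\<in>J. P (map f (sorted_list_of_set {j \<in> J. j < i})) (f i)"
      and "map f (sorted_list_of_set J) = us @ x # vs"
    then obtain us' i vs' where split: "sorted_list_of_set J = us' @ i # vs'"
      and "us = map f us'" "x = f i"
      by (auto simp: map_eq_append_conv map_eq_Cons_conv Cons_eq_map_conv)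
    moreover have "i \<in> J"
      using assms split by (metis in_set_conv_decomp set_sorted_list_of_set)
    ultimately show "P us x"
      using R prefix by auto
  qed
qed

lemma count_list_map_sorted_list_of_set:
  assumes "finite K"
  shows "count_list (map f (sorted_list_of_set K)) x = card {j \<in> K. f j = x}"
proof -
  have "count_list (map f js) x = length (filter (\<lambda>j. f j = x) js)" for js :: "'a list"
    by (induction js) auto
  then show ?thesis
    using assms by (simp add: distinct_length_filter Int_def conj_commute)
qed

text \<open>The hypothesis \<open>total\<close> supplies the final balance, so only the conditions
  at individual indices remain; restricting to the subsequence does not alter the counts of
  \<open>a\<close>, \<open>b\<close> and \<open>g\<close>.\<close>

lemma subsequence_concat_pairs_iff:
  fixes I :: "'i::linorder set"
  assumes fin: "\<forall>x\<in>{a, b, g}. finite {i \<in> I. f i = x}"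
    and total: "card {i \<in> I. f i = g} = card {i \<in> I. f i = a} + card {i \<in> I. f i = b}"
    and ne: "a \<noteq> b" "g \<noteq> a" "g \<noteq> b"
  shows "(\<exists>ps. set ps \<subseteq> {[a, g], [b, g]} \<and>
      subsequence_list f {j \<in> I. f j \<in> {a, b, g}} = concat ps) \<longleftrightarrow>
    (\<forall>i\<in>I. f i \<in> {a, b, g} \<longrightarrow>
      card {j \<in> I. j < i \<and> f j = a} + card {j \<in> I. j < i \<and> f j = b} =
      card {j \<in> I. j < i \<and> f j = g} + (if f i = g then 1 else 0))"
proof -
  let ?J = "{j \<in> I. f j \<in> {a, b, g}}"
  have "?J = {i \<in> I. f i = a} \<union> {i \<in> I. f i = b} \<union> {i \<in> I. f i = g}"
    by auto
  then have J: "finite ?J"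
    using fin by simp
  have J_less: "finite {j \<in> ?J. j < i}" for i
    by (rule finite_subset[OF _ J]) auto
  have set: "set (map f (sorted_list_of_set ?J)) \<subseteq> {a, b, g}"
    using J by auto
  have counts: "{j \<in> ?J. f j = x} = {j \<in> I. f j = x}"
    "{j \<in> {j \<in> ?J. j < i}. f j = x} = {j \<in> I. j < i \<and> f j = x}" if "x \<in> {a, b, g}" for x i
    using that by blast+
  have mem: "a \<in> {a, b, g}" "b \<in> {a, b, g}" "g \<in> {a, b, g}"
    by simp_all
  show ?thesis
    unfolding subsequence_list_def concat_pairs_iff[OF set ne] map_sorted_list_of_set_splits[OF J]
      count_list_map_sorted_list_of_set[OF J] count_list_map_sorted_list_of_set[OF J_less]
      counts[OF mem(1)] counts[OF mem(2)] counts[OF mem(3)] total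
    by (simp only: ball_simps mem_Collect_eq) blast
qed

section \<open>Additivity of root counts and the balance condition\<close>

context based_root_system
begin

lemma root_count_additive_iff_balance:
  fixes I :: "'i::linorder set"
  assumes pos: "\<forall>i\<in>I. b i \<in> positive_roots \<Phi> \<Delta>"
  defines "N \<equiv> root_count \<Phi> \<Delta> I b"
  shows "(\<forall>\<alpha>\<in>\<Phi>. \<forall>\<beta>\<in>\<Phi>. \<forall>\<gamma>\<in>\<Phi>. \<forall>k::int. \<forall>i\<in>I.
            \<alpha> \<noteq> \<beta> \<and> \<alpha> \<noteq> - \<beta> \<and> coroot B \<gamma> = coroot B \<alpha> + of_int k *\<^sub>R coroot B \<beta> \<and> b i = \<beta> \<longrightarrow>
            N i \<gamma> = N i \<alpha> + k * N i \<beta>)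
         \<longleftrightarrow>
         (\<forall>\<alpha>\<in>positive_roots \<Phi> \<Delta>. \<forall>\<beta>\<in>positive_roots \<Phi> \<Delta>. \<forall>\<gamma>\<in>positive_roots \<Phi> \<Delta>.
            coroot B \<gamma> = coroot B \<alpha> + coroot B \<beta> \<longrightarrow>
            (\<forall>i\<in>I. b i \<in> {\<alpha>, \<beta>, \<gamma>} \<longrightarrow>
              N i \<alpha> + N i \<beta> = N i \<gamma> + (if b i = \<gamma> then 1 else 0)))"
    (is "?L \<longleftrightarrow> ?R")
proof
  assume L: ?L
  have L1: "N i \<gamma> = N i \<alpha> + N i \<beta>"
    if "\<alpha> \<in> \<Phi>" "\<beta> \<in> \<Phi>" "\<gamma> \<in> \<Phi>" "i \<in> I" "\<alpha> \<noteq> \<beta>" "\<alpha> \<noteq> - \<beta>"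
      "coroot B \<gamma> = coroot B \<alpha> + coroot B \<beta>" "b i = \<beta>" for \<alpha> \<beta> \<gamma> i
    using L[rule_format, of \<alpha> \<beta> \<gamma> i 1] that by simp
  show ?R
  proof (intro ballI impI)
    fix \<alpha> \<beta> \<gamma> i
    assume pr: "\<alpha> \<in> positive_roots \<Phi> \<Delta>" "\<beta> \<in> positive_roots \<Phi> \<Delta>" "\<gamma> \<in> positive_roots \<Phi> \<Delta>"
      and sum: "coroot B \<gamma> = coroot B \<alpha> + coroot B \<beta>" and i: "i \<in> I" "b i \<in> {\<alpha>, \<beta>, \<gamma>}"
    have r: "\<alpha> \<in> \<Phi>" "\<beta> \<in> \<Phi>" "\<gamma> \<in> \<Phi>"
      using pr positive_imp_root by blast+
    note ne = distinct_of_coroot_sum[OF pr(1,2) r(3) sum]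
    consider "b i = \<alpha>" | "b i = \<beta>" | "b i = \<gamma>"
      using i by blast
    then show "N i \<alpha> + N i \<beta> = N i \<gamma> + (if b i = \<gamma> then 1 else 0)"
    proof cases
      case 1
      have "\<beta> \<noteq> - \<alpha>"
        using ne by auto
      then have "N i \<gamma> = N i \<beta> + N i \<alpha>"
        using ne by (intro L1) (auto simp: r i sum 1)
      then show ?thesis
        using 1 ne by auto
    next
      case 2
      have "N i \<gamma> = N i \<alpha> + N i \<beta>"
        using ne by (intro L1) (auto simp: r i sum 2)
      then show ?thesis
        using 2 ne by auto
    next
      case 3
      \<comment> \<open>With \<gamma> as the current entry, the relation is rewritten with
        \<open>- \<beta>\<close>; the extra 1 comes from its count, which is 1 minus that of
        \<beta>.\<close>
      have "- \<beta> \<noteq> \<gamma>" "- \<beta> \<noteq> - \<gamma>"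
        using ne by auto
      then have "N i \<alpha> = N i (- \<beta>) + N i \<gamma>"
        by (intro L1) (auto simp: r i sum 3 uminus_root coroot_uminus)
      then show ?thesis
        using 3 by (simp add: N_def root_count_uminus r)
    qed
  qed
next
  assume R: ?R
  have pair: "N i \<gamma> = N i \<alpha> + N i \<beta>"
    if "\<alpha> \<in> positive_roots \<Phi> \<Delta>" "\<beta> \<in> positive_roots \<Phi> \<Delta>" "\<gamma> \<in> positive_roots \<Phi> \<Delta>"
      "coroot B \<gamma> = coroot B \<alpha> + coroot B \<beta>" "i \<in> I" "b i = \<beta>" for \<alpha> \<beta> \<gamma> i
    using R[rule_format, of \<alpha> \<beta> \<gamma> i] that distinct_of_coroot_sum[of \<alpha> \<beta> \<gamma>] positive_imp_root
    by auto
  have step: "N i \<gamma> = N i \<alpha> + N i (b i)"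
    if r: "\<alpha> \<in> \<Phi>" "\<gamma> \<in> \<Phi>" and i: "i \<in> I"
      and sum: "coroot B \<gamma> = coroot B \<alpha> + coroot B (b i)" for \<alpha> \<gamma> i
  proof -
    have b: "b i \<in> positive_roots \<Phi> \<Delta>"
      using pos i by blast
    \<comment> \<open>Since \<open>b i\<close> is positive, a positive \<alpha> forces a positive
      \<gamma>, so three sign patterns remain.\<close>
    consider (pp) "\<alpha> \<in> positive_roots \<Phi> \<Delta>"
      | (np) "- \<alpha> \<in> positive_roots \<Phi> \<Delta>" "\<gamma> \<in> positive_roots \<Phi> \<Delta>"
      | (nn) "- \<alpha> \<in> positive_roots \<Phi> \<Delta>" "- \<gamma> \<in> positive_roots \<Phi> \<Delta>"
      using uminus_positive_iff r by blast
    then show ?thesis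
    proof cases
      case pp
      then show ?thesis
        using pair[of \<alpha> "b i" \<gamma> i] coroot_sum_positive[of \<alpha> "b i" \<gamma>] b i sum r by simp
    next
      case np
      \<comment> \<open>Now \<open>b i\<close> plays the role of the sum, where the balance is 1;
        this 1 cancels the one in the count of \<open>- \<alpha>\<close>.\<close>
      have "coroot B (b i) = coroot B \<gamma> + coroot B (- \<alpha>)"
        using sum by (simp add: coroot_uminus)
      moreover have "b i \<noteq> \<gamma>"
        using sum coroots.root_nonzero r by auto
      ultimately have "N i \<gamma> + N i (- \<alpha>) = N i (b i) + 1"
        using R[rule_format, of \<gamma> "- \<alpha>" "b i" i] np b i by simp
      then show ?thesis
        by (simp add: N_def root_count_uminus r)
    next
      case nn
      have "coroot B (- \<alpha>) = coroot B (- \<gamma>) + coroot B (b i)"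
        using sum by (simp add: coroot_uminus)
      then have "N i (- \<alpha>) = N i (- \<gamma>) + N i (b i)"
        using pair nn b i by blast
      then show ?thesis
        by (simp add: N_def root_count_uminus r)
    qed
  qed
  \<comment> \<open>The string is walked one coroot at a time:
    \<open>coroots.root_string_step\<close> makes every intermediate point a coroot, so
    \<open>step\<close> applies each time.\<close>
  have multiple: "N i \<gamma> = N i \<alpha> + int k * N i (b i)"
    if r: "\<alpha> \<in> \<Phi>" "\<gamma> \<in> \<Phi>" and i: "i \<in> I" and ne: "\<alpha> \<noteq> b i" "\<alpha> \<noteq> - b i"
      and sum: "coroot B \<gamma> = coroot B \<alpha> + real k *\<^sub>R coroot B (b i)" for \<alpha> \<gamma> i k
    using r ne sum
  proof (induction k arbitrary: \<alpha>)
    case 0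
    then show ?case
      using inj_on_coroot by (auto dest: inj_onD)
  next
    case (Suc k)
    have b: "b i \<in> \<Phi>"
      using pos i positive_imp_root by blast
    have cne: "coroot B \<alpha> \<noteq> coroot B (b i)" "coroot B \<alpha> \<noteq> - coroot B (b i)"
      using Suc.prems b uminus_root inj_onD[OF inj_on_coroot] by (metis coroot_uminus)+
    have "coroot B \<alpha> + coroot B (b i) \<in> coroot B ` \<Phi>"
      using coroots.root_string_step[of "coroot B \<alpha>" "coroot B (b i)" "Suc k"] cne Suc.prems b
      by (metis imageI zero_less_Suc)
    then obtain \<delta> where \<delta>: "\<delta> \<in> \<Phi>" "coroot B \<delta> = coroot B \<alpha> + coroot B (b i)"
      by auto
    \<comment> \<open>The induction hypothesis needs \<delta> to differ from \<open>b i\<close> and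
      \<open>- b i\<close>; equality would make the coroot of \<alpha> equal to 0 or to -2 times
      that of \<open>b i\<close>.\<close>
    have "\<delta> \<noteq> b i"
      using \<delta> coroots.root_nonzero Suc.prems(1) by auto
    moreover have "\<delta> \<noteq> - b i"
    proof
      assume "\<delta> = - b i"
      then have "coroot B \<alpha> = - coroot B (b i) - coroot B (b i)"
        using \<delta> by (simp add: coroot_uminus eq_diff_eq)
      then have "coroot B \<alpha> = (-2) *\<^sub>R coroot B (b i)"
        by (simp add: scaleR_2)
      then show False
        using coroots.reduced[of "coroot B (b i)" "-2"] b Suc.prems(1)
          imageI[of \<alpha> \<Phi> "coroot B"] by auto
    qed
    moreover have "coroot B \<gamma> = coroot B \<delta> + real k *\<^sub>R coroot B (b i)"
      using Suc.prems \<delta> by (simp add: algebra_simps)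
    ultimately have "N i \<gamma> = N i \<delta> + int k * N i (b i)"
      using Suc.IH \<delta> Suc.prems by blast
    moreover have "N i \<delta> = N i \<alpha> + N i (b i)"
      using step \<delta> Suc.prems i by blast
    ultimately show ?case
      by (simp add: algebra_simps)
  qed
  show ?L
  proof (intro ballI allI impI, elim conjE)
    fix \<alpha> \<beta> \<gamma> k i
    assume r: "\<alpha> \<in> \<Phi>" "\<beta> \<in> \<Phi>" "\<gamma> \<in> \<Phi>" and i: "i \<in> I" "b i = \<beta>"
      and ne: "\<alpha> \<noteq> \<beta>" "\<alpha> \<noteq> - \<beta>"
      and sum: "coroot B \<gamma> = coroot B \<alpha> + of_int k *\<^sub>R coroot B \<beta>"
    show "N i \<gamma> = N i \<alpha> + k * N i \<beta>"
    proof (cases "k \<ge> 0")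
      case True
      then show ?thesis
        using multiple[of \<alpha> \<gamma> i "nat k"] r i ne sum by simp
    next
      case False
      \<comment> \<open>For negative \<open>k\<close> the string is walked from \<gamma> back to
        \<alpha>. This requires \<gamma> not to be plus or minus \<beta>; otherwise the coroot of
        \<alpha> would be a multiple of that of \<beta>, contrary to \<open>ne\<close>.\<close>
      have parallel: "\<alpha> = \<beta> \<or> \<alpha> = - \<beta>" if "coroot B \<alpha> = c *\<^sub>R coroot B \<beta>" for c
      proof -
        have "c = 1 \<or> c = -1"
          using coroots.reduced[of "coroot B \<beta>" c] that r by (metis imageI)
        then have "coroot B \<alpha> = coroot B \<beta> \<or> coroot B \<alpha> = coroot B (- \<beta>)"
          using that by (auto simp: coroot_uminus)
        then show ?thesis
          using inj_onD[OF inj_on_coroot] r uminus_root by blast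
      qed
      have sum': "coroot B \<alpha> = coroot B \<gamma> + real (nat (- k)) *\<^sub>R coroot B \<beta>"
        using sum False by simp
      have "\<gamma> \<noteq> \<beta>"
        using parallel[of "1 + real (nat (- k))"] sum' ne by (auto simp: scaleR_add_left)
      moreover have "\<gamma> \<noteq> - \<beta>"
        using parallel[of "real (nat (- k)) - 1"] sum' ne
        by (auto simp: scaleR_diff_left coroot_uminus)
      ultimately have "N i \<alpha> = N i \<gamma> + int (nat (- k)) * N i \<beta>"
        using multiple[of \<gamma> \<alpha> i "nat (- k)"] r i sum' by blast
      then show ?thesis
        using False by simp
    qed
  qed
qed

end

theorem proposition4p4:
  fixes B :: "'v::real_vector \<Rightarrow> 'v \<Rightarrow> real"
    and \<Phi> \<Delta> :: "'v set"
    and lam :: 'v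
    and I :: "'i::linorder set"
    and b :: "'i \<Rightarrow> 'v"
  assumes "\<exists>S :: 'v set. finite S \<and> span S = UNIV"
    and "nondegenerate_symmetric_form B"
    and "root_system B \<Phi>"
    and "simple_roots \<Phi> \<Delta>"
    and "integral_weight B \<Delta> lam"
    and "dominant B \<Phi> \<Delta> lam"
    and "\<forall>i\<in>I. b i \<in> positive_roots \<Phi> \<Delta>"
    and "\<forall>\<alpha>\<in>positive_roots \<Phi> \<Delta>.
           finite {i \<in> I. b i = \<alpha>} \<and> real (card {i \<in> I. b i = \<alpha>}) = B lam (coroot B \<alpha>)"
  shows "(\<forall>\<alpha>\<in>\<Phi>. \<forall>\<beta>\<in>\<Phi>. \<forall>\<gamma>\<in>\<Phi>. \<forall>k::int. \<forall>i\<in>I.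
            \<alpha> \<noteq> \<beta> \<and> \<alpha> \<noteq> - \<beta> \<and> coroot B \<gamma> = coroot B \<alpha> + of_int k *\<^sub>R coroot B \<beta> \<and> b i = \<beta> \<longrightarrow>
            root_count \<Phi> \<Delta> I b i \<gamma> = root_count \<Phi> \<Delta> I b i \<alpha> + k * root_count \<Phi> \<Delta> I b i \<beta>)
         \<longleftrightarrow>
         (\<forall>\<alpha>\<in>positive_roots \<Phi> \<Delta>. \<forall>\<beta>\<in>positive_roots \<Phi> \<Delta>. \<forall>\<gamma>\<in>positive_roots \<Phi> \<Delta>.
            coroot B \<gamma> = coroot B \<alpha> + coroot B \<beta> \<longrightarrow>
            (\<exists>ps. set ps \<subseteq> {[\<alpha>, \<gamma>], [\<beta>, \<gamma>]} \<and>
                  subsequence_list b {j \<in> I. b j \<in> {\<alpha>, \<beta>, \<gamma>}} = concat ps))"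
proof -
  interpret based_root_system B \<Phi> \<Delta>
    using assms(2-4) by unfold_locales
  note fin = assms(8)[rule_format, THEN conjunct1]
    and card = assms(8)[rule_format, THEN conjunct2]
  have balance: "(\<forall>i\<in>I. b i \<in> {\<alpha>, \<beta>, \<gamma>} \<longrightarrow>
        root_count \<Phi> \<Delta> I b i \<alpha> + root_count \<Phi> \<Delta> I b i \<beta> =
        root_count \<Phi> \<Delta> I b i \<gamma> + (if b i = \<gamma> then 1 else 0)) \<longleftrightarrow>
      (\<exists>ps. set ps \<subseteq> {[\<alpha>, \<gamma>], [\<beta>, \<gamma>]} \<and>
        subsequence_list b {j \<in> I. b j \<in> {\<alpha>, \<beta>, \<gamma>}} = concat ps)"
    if pr: "\<alpha> \<in> positive_roots \<Phi> \<Delta>" "\<beta> \<in> positive_roots \<Phi> \<Delta>" "\<gamma> \<in> positive_roots \<Phi> \<Delta>"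
      and sum: "coroot B \<gamma> = coroot B \<alpha> + coroot B \<beta>" for \<alpha> \<beta> \<gamma>
  proof -
    note ne = distinct_of_coroot_sum[OF pr(1,2) positive_imp_root[OF pr(3)] sum]
    \<comment> \<open>The prescribed multiplicities are values of the pairing with
      \<open>lam\<close>, which is linear in the coroot.\<close>
    have "real (card {i \<in> I. b i = \<gamma>}) = real (card {i \<in> I. b i = \<alpha>} + card {i \<in> I. b i = \<beta>})"
      using card pr by (simp add: sum form_simps)
    then have total: "card {i \<in> I. b i = \<gamma>} = card {i \<in> I. b i = \<alpha>} + card {i \<in> I. b i = \<beta>}"
      by (simp only: of_nat_eq_iff)
    have finite: "\<forall>x\<in>{\<alpha>, \<beta>, \<gamma>}. finite {i \<in> I. b i = x}"
      using fin pr by blast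
    \<comment> \<open>\<open>root_count\<close> is integer-valued, while the criterion for pairs
      compares natural numbers; on positive roots the two agree.\<close>
    have "int m + int n = int p + (if Q then 1 else 0) \<longleftrightarrow> m + n = p + (if Q then 1 else 0)"
      for m n p Q
      by auto
    then show ?thesis
      unfolding subsequence_concat_pairs_iff[OF finite total ne(1-3)]
      using pr by (simp only: root_count_def if_True)
  qed
  show ?thesis
    unfolding root_count_additive_iff_balance[OF assms(7)] using balance by (intro ball_cong refl) simp
qed

end
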